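(* Let $a \le b$ be integers and let $[a,b]_{\mathbb{Z}} = \{z \in \mathbb{Z} : a \le z \le b\}$. The digital image $([a,b]_{\mathbb{Z}}, c_1)$ has the approximate fixed point property for continuous multivalued functions ($AFPP_M$); that is, for every $(c_1,c_1)$-continuous multivalued function $F: [a,b]_{\mathbb{Z}} \multimap [a,b]_{\mathbb{Z}}$ there exist $x \in [a,b]_{\mathbb{Z}}$ and $y \in F(x)$ such that $x = y$ or $x$ and $y$ are $c_1$-adjacent.
   Context: A digital image $(X,\kappa)$ is a set $X \subset \mathbb{Z}^n$ with an adjacency relation $\kappa$ (symmetric, irreflexive), here the restriction of an adjacency on $\mathbb{Z}^n$. For distinct $x,y \in \mathbb{Z}^n$ and $1 \le u \le n$, $x$ and $y$ are $c_u$-adjacent if there are at most $u$ indices $i$ with $|x_i-y_i|=1$, and $x_j=y_j$ for all other indices $j$. In particular, in $\mathbb{Z}$, $c_1$-adjacent means differing by exactly $1$. Single-valued continuity: a set is $\kappa$-connected if any two of its points are joined by a finite sequence of points in it with consecutive terms equal or $\kappa$-adjacent. A function $f$ between digital images with adjacencies $\kappa$ and $\lambda$ is $(\kappa,\lambda)$-continuous if it maps $\kappa$-connected sets to $\lambda$-connected sets; equivalently, $x,x'$ $\kappa$-adjacent implies $f(x),f(x')$ are equal or $\lambda$-adjacent. Multivalued continuity: a multivalued function $F: X \multimap Y$ assigns a subset $F(x)$ of $Y$ to each $x \in X$. For a positive integer $r$, let $\mathbb{Z}^n_r = \{(z_1/r,\ldots,z_n/r) : z_i \in \mathbb{Z}\}$,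 with the adjacency (also called $\kappa$) in which $(z_1/r,\ldots,z_n/r)$ and $(z_1'/r,\ldots,z_n'/r)$ are adjacent iff $(z_1,\ldots,z_n)$ and $(z'_1,\ldots,z'_n)$ are $\kappa$-adjacent in $\mathbb{Z}^n$. For $X \subset \mathbb{Z}^n$ let $S(X,r) = \{(x_1,\ldots,x_n)\in \mathbb{Z}^n_r : (\lfloor x_1\rfloor,\ldots,\lfloor x_n\rfloor) \in X\}$ and $E_r: S(X,r)\to X$, $E_r(x_1,\ldots,x_n) = (\lfloor x_1\rfloor,\ldots,\lfloor x_n\rfloor)$. A function $f: S(X,r) \to Y$ induces the multivalued function $F(x) = \{f(x') : x' \in E_r^{-1}(x)\}$. A multivalued function $F: X \multimap Y$ is $(\kappa,\lambda)$-continuous if for some positive integer $r$ it is induced by some single-valued $(\kappa,\lambda)$-continuous function $f: S(X,r)\to Y$. *)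

theory Defs
  imports "HOL-Analysis.Analysis"
begin

text \<open>Points of \<open>\<int>\<^sup>n\<close> are vectors \<^typ>\<open>int ^ 'n\<close>; in particular \<open>\<int>\<close> as a space of digital
  points is \<^typ>\<open>int ^ 1\<close>. A digital image is a set together with an adjacency on the ambient
  space; the restriction to the set is implicit.\<close>

definition c_adj :: "nat \<Rightarrow> int ^ 'n \<Rightarrow> int ^ 'n \<Rightarrow> bool" where
  "c_adj u x y \<longleftrightarrow> x \<noteq> y \<and> card {i. \<bar>x $ i - y $ i\<bar> = 1} \<le> u
     \<and> (\<forall>j. \<bar>x $ j - y $ j\<bar> \<noteq> 1 \<longrightarrow> x $ j = y $ j)"

lemma c_adj_sym: "c_adj u x y \<Longrightarrow> c_adj u y x"
  by (auto simp: c_adj_def abs_minus_commute[of "y $ _" "x $ _"])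

lemma c_adj_irrefl: "\<not> c_adj u x x"
  by (simp add: c_adj_def)

lemma c_adj_1_dim1: "c_adj 1 (x :: int ^ 1) y \<longleftrightarrow> \<bar>x $ 1 - y $ 1\<bar> = 1"
proof -
  have card1: "card {i :: 1. P i} \<le> 1" for P
    using card_mono[of "UNIV :: 1 set" "{i. P i}"] by (simp del: UNIV_1)
  have "x = y \<longleftrightarrow> x $ 1 = y $ 1"
    by (simp add: vec_eq_iff forall_1)
  then show ?thesis
    unfolding c_adj_def forall_1 using card1[of "\<lambda>i. \<bar>x $ i - y $ i\<bar> = 1"] by linarith
qed

definition adj_connected :: "('a \<Rightarrow> 'a \<Rightarrow> bool) \<Rightarrow> 'a set \<Rightarrow> bool" where
  "adj_connected \<kappa> A \<longleftrightarrow> (\<forall>x\<in>A. \<forall>y\<in>A. \<exists>ps. ps \<noteq> [] \<and> hd ps = x \<and> last ps = y \<and> set ps \<subseteq> A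
     \<and> successively (\<lambda>p q. p = q \<or> \<kappa> p q) ps)"

definition digitally_continuous ::
    "('a \<Rightarrow> 'a \<Rightarrow> bool) \<Rightarrow> ('b \<Rightarrow> 'b \<Rightarrow> bool) \<Rightarrow> 'a set \<Rightarrow> 'b set \<Rightarrow> ('a \<Rightarrow> 'b) \<Rightarrow> bool" where
  "digitally_continuous \<kappa> \<mu> X Y f \<longleftrightarrow>
     f \<in> X \<rightarrow> Y \<and> (\<forall>A\<subseteq>X. adj_connected \<kappa> A \<longrightarrow> adj_connected \<mu> (f ` A))"

definition scale_point :: "nat \<Rightarrow> int ^ 'n \<Rightarrow> real ^ 'n" where
  "scale_point r z = (\<chi> i. of_int (z $ i) / of_nat r)"

definition fine_grid :: "nat \<Rightarrow> (real ^ 'n) set" where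
  "fine_grid r = range (scale_point r)"

definition fine_adj ::
    "nat \<Rightarrow> (int ^ 'n \<Rightarrow> int ^ 'n \<Rightarrow> bool) \<Rightarrow> real ^ 'n \<Rightarrow> real ^ 'n \<Rightarrow> bool" where
  "fine_adj r \<kappa> p q \<longleftrightarrow> (\<exists>z z'. p = scale_point r z \<and> q = scale_point r z' \<and> \<kappa> z z')"

definition floor_vec :: "real ^ 'n \<Rightarrow> int ^ 'n" where
  "floor_vec p = (\<chi> i. \<lfloor>p $ i\<rfloor>)"

definition subdivision :: "(int ^ 'n) set \<Rightarrow> nat \<Rightarrow> (real ^ 'n) set" where
  "subdivision X r = {p \<in> fine_grid r. floor_vec p \<in> X}"

text \<open>The map \<open>E\<^sub>r\<close> is the restriction of \<^const>\<open>floor_vec\<close> to \<^term>\<open>subdivision X r\<close>.\<close>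

definition induced_by ::
    "(int ^ 'n) set \<Rightarrow> nat \<Rightarrow> (real ^ 'n \<Rightarrow> 'b) \<Rightarrow> (int ^ 'n \<Rightarrow> 'b set) \<Rightarrow> bool" where
  "induced_by X r f F \<longleftrightarrow> (\<forall>x\<in>X. F x = f ` {p \<in> subdivision X r. floor_vec p = x})"

definition multivalued_function :: "'a set \<Rightarrow> 'b set \<Rightarrow> ('a \<Rightarrow> 'b set) \<Rightarrow> bool" where
  "multivalued_function X Y F \<longleftrightarrow> (\<forall>x\<in>X. F x \<subseteq> Y)"

definition continuous_multivalued ::
    "(int ^ 'n \<Rightarrow> int ^ 'n \<Rightarrow> bool) \<Rightarrow> (int ^ 'm \<Rightarrow> int ^ 'm \<Rightarrow> bool) \<Rightarrow>
     (int ^ 'n) set \<Rightarrow> (int ^ 'm) set \<Rightarrow> (int ^ 'n \<Rightarrow> (int ^ 'm) set) \<Rightarrow> bool" where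
  "continuous_multivalued \<kappa> \<mu> X Y F \<longleftrightarrow> multivalued_function X Y F \<and>
     (\<exists>r>0. \<exists>f. digitally_continuous (fine_adj r \<kappa>) \<mu> (subdivision X r) Y f \<and> induced_by X r f F)"

definition AFPP_M :: "(int ^ 'n) set \<Rightarrow> (int ^ 'n \<Rightarrow> int ^ 'n \<Rightarrow> bool) \<Rightarrow> bool" where
  "AFPP_M X \<kappa> \<longleftrightarrow> (\<forall>F. continuous_multivalued \<kappa> \<kappa> X X F \<longrightarrow>
     (\<exists>x\<in>X. \<exists>y\<in>F x. x = y \<or> \<kappa> x y))"

definition digital_interval :: "int \<Rightarrow> int \<Rightarrow> (int ^ 1) set" where
  "digital_interval a b = {z. a \<le> z $ 1 \<and> z $ 1 \<le> b}"

end

theory Submission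
  imports Defs
begin

text \<open>Writing the points of the subdivided interval as \<open>k / r\<close>, the integer-valued function
  \<open>h k = f (k / r) - \<lfloor>k / r\<rfloor>\<close> is nonnegative at the left end, nonpositive at the right end, and
  drops by at most 2 in one step of \<open>k\<close>. At the first \<open>k\<close> with \<open>h k \<le> 1\<close> therefore
  \<open>h k \<ge> 0\<close>, so \<open>\<lfloor>k / r\<rfloor>\<close> is an approximate fixed point.\<close>

text \<open>By induction on the list: if the second entry is again \<open>u\<close>, the tail is
  such a path; if it is \<open>v\<close>, the first step already relates \<open>u\<close> and
  \<open>v\<close>.\<close>

lemma successively_two_points:
  assumes "successively (\<lambda>p q. p = q \<or> R p q) ps" "ps \<noteq> []" "set ps \<subseteq> {u, v}"
    and "hd ps = u" "last ps = v"
  shows "u = v \<or> R u v"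
  using assms
proof (induction ps)
  case (Cons p ps)
  then show ?case
    by (cases ps) auto
qed simp

lemma adj_connected_pair:
  assumes "\<kappa> p q" "\<kappa> q p"
  shows "adj_connected \<kappa> {p, q}"
proof -
  have "\<exists>ps. ps \<noteq> [] \<and> hd ps = x \<and> last ps = y \<and> set ps \<subseteq> {p, q}
      \<and> successively (\<lambda>p q. p = q \<or> \<kappa> p q) ps" if "x \<in> {p, q}" "y \<in> {p, q}" for x y
    using that assms by (intro exI[of _ "[x, y]"]) auto
  then show ?thesis
    by (auto simp: adj_connected_def)
qed

text \<open>Recovers the adjacency form of continuity: the image of a connected pair is connected
  with at most two points, so its endpoints are equal or adjacent. Adjacency is assumed in both
  directions because \<open>\<kappa>\<close> need not be symmetric here.\<close>

lemma digitally_continuous_adj: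
  assumes f: "digitally_continuous \<kappa> \<mu> X Y f"
    and "p \<in> X" "q \<in> X" "\<kappa> p q" "\<kappa> q p"
  shows "f p = f q \<or> \<mu> (f p) (f q)"
proof -
  have "adj_connected \<mu> (f ` {p, q})"
    using f[unfolded digitally_continuous_def, THEN conjunct2, rule_format, of "{p, q}"]
      adj_connected_pair[of \<kappa> p q] assms(2-) by simp
  then have "\<exists>ps. ps \<noteq> [] \<and> hd ps = f p \<and> last ps = f q \<and> set ps \<subseteq> f ` {p, q}
      \<and> successively (\<lambda>p q. p = q \<or> \<mu> p q) ps"
    unfolding adj_connected_def by (elim ballE[of _ _ "f p"] ballE[of _ _ "f q"]) simp_all
  then show ?thesis
    by (elim exE conjE, intro successively_two_points) simp_all
qed

lemma fine_adj_scale_point: "\<kappa> z z' \<Longrightarrow> fine_adj r \<kappa> (scale_point r z) (scale_point r z')"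
  by (auto simp: fine_adj_def)

lemma floor_vec_scale_point: "floor_vec (scale_point r z) = (\<chi> i. z $ i div int r)"
proof -
  have "\<lfloor>of_int k / of_nat r :: real\<rfloor> = k div int r" for k
    using floor_divide_of_int_eq[of k "int r", where 'a = real] by simp
  then show ?thesis
    by (simp add: floor_vec_def scale_point_def)
qed

lemma discrete_approximate_zero:
  fixes h :: "int \<Rightarrow> int"
  assumes "m \<le> n" "0 \<le> h m" "h n \<le> 0"
    and step: "\<And>k. \<lbrakk>m \<le> k; k < n\<rbrakk> \<Longrightarrow> h k - 2 \<le> h (k + 1)"
  shows "\<exists>k. m \<le> k \<and> k \<le> n \<and> \<bar>h k\<bar> \<le> 1"
proof -
  \<comment> \<open>Invariant: a small value has already occurred, or \<open>h\<close> is still at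
    least 2. At \<open>n\<close> the second alternative contradicts \<open>h n \<le> 0\<close>.
    Upward jumps do no harm.\<close>
  have "(\<exists>k. m \<le> k \<and> k \<le> j \<and> \<bar>h k\<bar> \<le> 1) \<or> 2 \<le> h j" if "m \<le> j" "j \<le> n" for j
    using that
  proof (induction j rule: int_ge_induct)
    case base
    show ?case
    proof (cases "h m \<le> 1")
      case True
      then show ?thesis
        using \<open>0 \<le> h m\<close> by (intro disjI1 exI[of _ m]) auto
    qed simp
  next
    case (step j)
    show ?case
    proof (cases "2 \<le> h j \<and> h (j + 1) \<le> 1")
      case True
      then have "\<bar>h (j + 1)\<bar> \<le> 1"
        using assms(4)[of j] step.hyps step.prems by simp
      then show ?thesis
        using step.hyps by (intro disjI1 exI[of _ "j + 1"]) simp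
    next
      case False
      then show ?thesis
        using step.IH step.prems by force
    qed
  qed
  from this[of n] show ?thesis
    using assms(1,3) by auto
qed

theorem theorem3p1:
  fixes a b :: int
  assumes "a \<le> b"
  shows "AFPP_M (digital_interval a b) (c_adj 1)"
  unfolding AFPP_M_def
proof (intro allI impI)
  fix F :: "int ^ 1 \<Rightarrow> (int ^ 1) set"
  let ?X = "digital_interval a b"
  assume "continuous_multivalued (c_adj 1) (c_adj 1) ?X ?X F"
  then obtain r f where "r > 0"
    and f: "digitally_continuous (fine_adj r (c_adj 1)) (c_adj 1) (subdivision ?X r) ?X f"
    and F: "induced_by ?X r f F"
    unfolding continuous_multivalued_def by blast
  define p :: "int \<Rightarrow> real ^ 1" where "p k = scale_point r (vec k)" for k
  define m where "m = a * int r"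
  \<comment> \<open>The last index over \<open>b\<close>: the grid points with floor
    \<open>b\<close> are \<open>b + i / r\<close> with \<open>0 \<le> i < r\<close>.\<close>
  define n where "n = b * int r + (int r - 1)"
  define h where "h k = f (p k) $ 1 - k div int r" for k
  have r: "int r > 0"
    using \<open>r > 0\<close> by simp
  have floor_p: "floor_vec (p k) = vec (k div int r)" for k
    by (simp add: p_def floor_vec_scale_point vec_eq_iff)
  have div_m: "m div int r = a"
    using r by (simp add: m_def)
  have div_n: "n div int r = b"
    using r by (simp add: n_def)
  have floor_in: "vec (k div int r) \<in> ?X" if "m \<le> k" "k \<le> n" for k
    using zdiv_mono1[OF that(1) r] zdiv_mono1[OF that(2) r] div_m div_n
    by (simp add: digital_interval_def)
  have p_in: "p k \<in> subdivision ?X r" if "m \<le> k" "k \<le> n" for k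
    using floor_in[OF that] floor_p[of k] by (simp add: subdivision_def fine_grid_def p_def)
  have fp_in: "f (p k) \<in> ?X" if "m \<le> k" "k \<le> n" for k
    using f p_in[OF that] by (auto simp: digitally_continuous_def)
  have "m \<le> n"
    using mult_right_mono[OF assms, of "int r"] r unfolding m_def n_def by linarith
  have "0 \<le> h m" "h n \<le> 0"
    using fp_in[of m] fp_in[of n] \<open>m \<le> n\<close>
    by (auto simp: h_def div_m div_n digital_interval_def)
  \<comment> \<open>The 2 is one unit from a possible decrease of \<open>f\<close> plus one from a
    possible increase of the floor.\<close>
  moreover have "h k - 2 \<le> h (k + 1)" if "m \<le> k" "k < n" for k
  proof -
    have "c_adj 1 (vec k :: int ^ 1) (vec (k + 1))" "c_adj 1 (vec (k + 1) :: int ^ 1) (vec k)"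
      unfolding c_adj_1_dim1 by simp_all
    then have "fine_adj r (c_adj 1) (p k) (p (k + 1))" "fine_adj r (c_adj 1) (p (k + 1)) (p k)"
      by (simp_all add: p_def fine_adj_scale_point)
    then have "f (p k) = f (p (k + 1)) \<or> c_adj 1 (f (p k)) (f (p (k + 1)))"
      using digitally_continuous_adj[OF f p_in p_in] that by simp
    then have "\<bar>f (p k) $ 1 - f (p (k + 1)) $ 1\<bar> \<le> 1"
      unfolding c_adj_1_dim1 by auto
    moreover have "(k + 1) div int r \<le> k div int r + 1"
      using zdiv_mono1[of "k + 1" "k + int r" "int r"] r by simp
    ultimately show ?thesis
      by (simp add: h_def)
  qed
  ultimately have "\<exists>k. m \<le> k \<and> k \<le> n \<and> \<bar>h k\<bar> \<le> 1"
    by (intro discrete_approximate_zero \<open>m \<le> n\<close>)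
  then obtain k where k: "m \<le> k" "k \<le> n" "\<bar>h k\<bar> \<le> 1"
    by blast
  let ?x = "vec (k div int r) :: int ^ 1"
  \<comment> \<open>\<open>p k\<close> lies in the fibre of the floor map over \<open>?x\<close>, so
    its image is one of the values of \<open>F\<close> there.\<close>
  have "f (p k) \<in> F ?x"
    using F floor_in[OF k(1,2)] p_in[OF k(1,2)] floor_p[of k] by (auto simp: induced_by_def)
  moreover have "?x = f (p k) \<or> c_adj 1 ?x (f (p k))"
  proof -
    have "?x $ 1 = f (p k) $ 1 \<or> \<bar>?x $ 1 - f (p k) $ 1\<bar> = 1"
      using k(3) by (simp add: h_def) linarith
    then show ?thesis
      unfolding c_adj_1_dim1 by (simp add: vec_eq_iff forall_1)
  qed
  ultimately show "\<exists>x\<in>?X. \<exists>y\<in>F x. x = y \<or> c_adj 1 x y"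
    using floor_in[OF k(1,2)] by (intro bexI)
qed

end
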